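(* Let $\pi=(d_1,d_2,\dots,d_n)$ be the degree sequence of a tree, with $d_1\ge d_2\ge\cdots\ge d_k\ge 2$ and $d_{k+1}=\cdots=d_n=1$, and let $\mathcal{T}_\pi$ be the set of all trees with degree sequence $\pi$. If $T^\ast\in\mathcal{T}_\pi$ is a minimum optimal tree in $\mathcal{T}_\pi$, i.e. $\varphi(T^\ast)=\min_{T\in\mathcal{T}_\pi}\varphi(T)$, then $T^\ast$ is a caterpillar.
   Context: A subtree of a tree $T$ is a (nonempty) connected subgraph of $T$; $\varphi(T)$ denotes the number of nonempty subtrees of $T$. A caterpillar is a tree containing a path such that every vertex not on the path is adjacent to some vertex on the path. *)

theory Defs
  imports "Graph_Theory.Graph_Theory" "HOL-Library.Multiset"
begin

text \<open>
  Finite simple undirected graphs are the symmetric loop-free finite digraphs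
  \<^locale>\<open>pair_graph\<close>: an edge between u and v is the pair of arcs (u, v), (v, u).
  The library's \<^const>\<open>tree\<close> is not usable for them, since its \<^const>\<open>forest\<close> also forbids
  the closed walk u, v, u along a single edge. In a loop-free graph, undirected cycles
  are exactly the directed cycles with at least three arcs.
\<close>

definition undirected_tree :: "'a pair_pre_digraph \<Rightarrow> bool" where
  "undirected_tree T \<longleftrightarrow>
     pair_graph T \<and> connected (with_proj T) \<and>
     (\<nexists>c. pre_digraph.cycle (with_proj T) c \<and> 3 \<le> length c)"

text \<open>
  Nonemptiness of subtrees is part of \<^const>\<open>connected\<close>; \<^const>\<open>subgraph\<close> alone would allow
  dropping only one of the two arcs of an edge, which \<^locale>\<open>pair_graph\<close> rules out.
\<close>

definition subtrees :: "'a pair_pre_digraph \<Rightarrow> 'a pair_pre_digraph set" where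
  "subtrees T =
     {H. pair_graph H \<and> subgraph (with_proj H) (with_proj T) \<and> connected (with_proj H)}"

definition num_subtrees :: "'a pair_pre_digraph \<Rightarrow> nat" where
  "num_subtrees T = card (subtrees T)"

text \<open>
  By symmetry, the degree of a vertex is its out-degree. Degree sequences are listed in
  non-increasing order.
\<close>

definition degree_sequence :: "'a pair_pre_digraph \<Rightarrow> nat list" where
  "degree_sequence G =
     rev (sorted_list_of_multiset
       (image_mset (out_degree (with_proj G)) (mset_set (pverts G))))"

text \<open>
  The trees live on the fixed vertex type \<^typ>\<open>'a\<close>. If one tree with degree sequence \<open>\<pi>\<close>
  exists there, then so does an isomorphic copy of every other such tree, because all of
  them have the same number of vertices.
\<close>

definition trees_with_degree_sequence :: "nat list \<Rightarrow> 'a pair_pre_digraph set" where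
  "trees_with_degree_sequence \<pi> = {T. undirected_tree T \<and> degree_sequence T = \<pi>}"

text \<open>The path may consist of a single vertex.\<close>

definition caterpillar :: "'a pair_pre_digraph \<Rightarrow> bool" where
  "caterpillar T \<longleftrightarrow>
     undirected_tree T \<and>
     (\<exists>p. vpath p (with_proj T) \<and>
        (\<forall>v \<in> pverts T - set p. \<exists>w \<in> set p. v \<rightarrow>\<^bsub>with_proj T\<^esub> w))"

end

theory Submission
  imports Defs "HOL-Combinatorics.Transposition"
begin

text \<open>
  Let \<open>p\<close> be a longest path of a minimal tree that is not a caterpillar. Then some vertex \<open>w\<close> of \<open>p\<close>
  has a neighbour \<open>a\<close> off \<open>p\<close> which is not a leaf. Moving everything that hangs at \<open>a\<close> to an end
  \<open>x\<close> of \<open>p\<close> exchanges the degrees of \<open>a\<close> and \<open>x\<close>. With \<open>V\<^sub>0\<close> the set of vertices that stay put,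
  in which both \<open>a\<close> and \<open>x\<close> are leaves, the number of subtrees drops as soon as fewer subtrees
  inside \<open>V\<^sub>0\<close> contain \<open>x\<close> than contain \<open>a\<close>.

  This holds for one of the two ends of \<open>p\<close>. Let \<open>B\<close> be the branch at \<open>w\<close> that contains \<open>x\<close>, with
  root \<open>b\<close>, let \<open>y\<close> be the neighbour of \<open>x\<close>, and let \<open>R\<close> be the number of subtrees of
  \<open>V\<^sub>0 - B - {a}\<close> containing \<open>w\<close>. Among the subtrees of \<open>B - {x}\<close>, let \<open>M\<close> contain both \<open>b\<close> and \<open>y\<close>,
  let \<open>N\<close> contain \<open>b\<close> but not \<open>y\<close>, and let \<open>Y\<close> contain \<open>y\<close>. Then \<open>a\<close> lies in
  \<open>1 + R (1 + N + 2 M)\<close> subtrees and \<open>x\<close> in \<open>1 + Y + 2 R M\<close>, while \<open>Y \<le> M + M N\<close>. If the branch in the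
  other direction of \<open>p\<close> has at least as many subtrees at its root as \<open>B\<close> has, then
  \<open>R \<ge> 1 + N + 2 M > M\<close>, and the claim follows.
\<close>

section \<open>Connected vertex sets\<close>

text \<open>Vertex sets stand in for subtrees: a connected subgraph of a tree is determined by its
  vertices. \<open>rtrancl_on S E\<close> keeps the whole walk inside \<open>S\<close>.\<close>

definition conn_set :: "'a rel \<Rightarrow> 'a set \<Rightarrow> bool" where
  "conn_set E S \<longleftrightarrow> S \<noteq> {} \<and> (\<forall>u\<in>S. \<forall>v\<in>S. (u, v) \<in> rtrancl_on S E)"

definition csets :: "'a rel \<Rightarrow> 'a set \<Rightarrow> 'a set set" where
  "csets E X = {S. S \<subseteq> X \<and> conn_set E S}"

text \<open>The map may collapse a step to a point, so the lemma covers contractions as well as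
  isomorphisms.\<close>

lemma rtrancl_on_map:
  assumes "(u, v) \<in> rtrancl_on F r"
    and "\<And>z. z \<in> F \<Longrightarrow> f z \<in> F'"
    and "\<And>p q. p \<in> F \<Longrightarrow> q \<in> F \<Longrightarrow> (p, q) \<in> r \<Longrightarrow> f p = f q \<or> (f p, f q) \<in> r'"
  shows "(f u, f v) \<in> rtrancl_on F' r'"
  using assms(1)
proof (induction rule: rtrancl_on_induct)
  case base
  then show ?case using assms(2) by simp
next
  case (step p q)
  then show ?case using assms(2,3)
    by (metis rtrancl_on_into_rtrancl_on)
qed

lemma rtrancl_on_symD: "sym r \<Longrightarrow> (u, v) \<in> rtrancl_on F r \<Longrightarrow> (v, u) \<in> rtrancl_on F r"
  by (meson rtrancl_on_sym symE)

lemma conn_setI_root: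
  assumes "sym E" "r \<in> S" "\<And>v. v \<in> S \<Longrightarrow> (r, v) \<in> rtrancl_on S E"
  shows "conn_set E S"
  unfolding conn_set_def
  using assms by (metis empty_iff rtrancl_on_symD rtrancl_on_trans)

lemma conn_set_singleton: "conn_set E {v}"
  by (simp add: conn_set_def)

text \<open>The case \<open>a = b\<close> serves parts that overlap, the case of an edge parts that
  are joined across it; all walks are taken from \<open>a\<close>.\<close>

lemma conn_set_Un:
  assumes "sym E" "conn_set E A" "conn_set E B" "a \<in> A" "b \<in> B" "a = b \<or> (a, b) \<in> E"
  shows "conn_set E (A \<union> B)"
proof (rule conn_setI_root[OF \<open>sym E\<close>, of a])
  show "a \<in> A \<union> B" using assms by simp
  have sub: "(u, v) \<in> rtrancl_on (A \<union> B) E" if "u \<in> S" "v \<in> S" "conn_set E S" "S = A \<or> S = B" for u v S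
    using that rtrancl_on_mono[of E E S "A \<union> B"] by (auto simp: conn_set_def)
  have ab: "(a, b) \<in> rtrancl_on (A \<union> B) E"
    using assms by (metis UnI1 UnI2 rtrancl_on_into_rtrancl_on rtrancl_on_refl)
  fix v assume "v \<in> A \<union> B"
  then show "(a, v) \<in> rtrancl_on (A \<union> B) E"
    using sub assms ab by (metis UnE rtrancl_on_trans)
qed

text \<open>Every prefix of a walk from \<open>b\<close> ends in the component, so the walk never
  leaves it.\<close>

lemma conn_set_component:
  assumes "sym E" "b \<in> F"
  shows "conn_set E {v. (b, v) \<in> rtrancl_on F E}" (is "conn_set E ?P")
proof (rule conn_setI_root[OF \<open>sym E\<close>, of b])
  show bP: "b \<in> ?P" using assms by simp
  fix v assume "v \<in> ?P"
  then have "(b, v) \<in> rtrancl_on F E" by simp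
  then show "(b, v) \<in> rtrancl_on ?P E"
  proof (induction rule: rtrancl_on_induct)
    case base
    then show ?case using bP by simp
  next
    case (step p q)
    then have "q \<in> ?P" by (auto intro: rtrancl_on_into_rtrancl_on)
    then show ?case using step by (blast intro: rtrancl_on_into_rtrancl_on)
  qed
qed

lemma conn_set_crossing:
  assumes "conn_set E S" "u \<in> S" "u \<in> Z" "v \<in> S" "v \<notin> Z"
  obtains p q where "p \<in> S" "p \<in> Z" "q \<in> S" "q \<notin> Z" "(p, q) \<in> E"
proof -
  have "(u, v) \<in> rtrancl_on S E" using assms by (simp add: conn_set_def)
  then have "v \<notin> Z \<longrightarrow> (\<exists>p q. p \<in> S \<and> p \<in> Z \<and> q \<in> S \<and> q \<notin> Z \<and> (p, q) \<in> E)"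
    using \<open>u \<in> Z\<close> by (induction rule: rtrancl_on_induct) blast+
  then show thesis using that assms by blast
qed

text \<open>Contracting \<open>S - Z\<close> to the attaching vertex \<open>h\<close> turns walks in \<open>S\<close> into walks in \<open>Z\<close>.\<close>

lemma conn_set_retract:
  assumes "sym E" "conn_set E S" "h \<in> Z" "Z \<subseteq> S"
    and "\<And>u v. u \<in> Z \<Longrightarrow> v \<in> S - Z \<Longrightarrow> (u, v) \<in> E \<Longrightarrow> u = h"
  shows "conn_set E Z"
  unfolding conn_set_def
proof (intro conjI ballI)
  show "Z \<noteq> {}" using assms by blast
  fix u v assume uv: "u \<in> Z" "v \<in> Z"
  let ?f = "\<lambda>z. if z \<in> Z then z else h"
  have "(u, v) \<in> rtrancl_on S E" using assms(2,4) uv unfolding conn_set_def by blast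
  then have "(?f u, ?f v) \<in> rtrancl_on Z E"
  proof (rule rtrancl_on_map)
    fix p q assume pq: "p \<in> S" "q \<in> S" "(p, q) \<in> E"
    then have "(q, p) \<in> E" using \<open>sym E\<close> by (simp add: symD)
    then show "?f p = ?f q \<or> (?f p, ?f q) \<in> E"
      using pq assms(5)[of p q] assms(5)[of q p] by auto
  qed (use assms(3) in simp)
  then show "(u, v) \<in> rtrancl_on Z E" using uv by simp
qed

lemma conn_set_map:
  assumes "conn_set E S" "\<And>p q. p \<in> S \<Longrightarrow> q \<in> S \<Longrightarrow> (p, q) \<in> E \<Longrightarrow> (f p, f q) \<in> E'"
  shows "conn_set E' (f ` S)"
  unfolding conn_set_def
proof (intro conjI ballI)
  show "f ` S \<noteq> {}" using assms by (simp add: conn_set_def)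
  fix u v assume "u \<in> f ` S" "v \<in> f ` S"
  then obtain p q where "p \<in> S" "u = f p" "q \<in> S" "v = f q" by blast
  then show "(u, v) \<in> rtrancl_on (f ` S) E'"
    using assms rtrancl_on_map[of p q S E f "f ` S" E'] by (auto simp: conn_set_def)
qed

section \<open>Counting connected sets\<close>

lemma finite_csets: "finite X \<Longrightarrow> finite (csets E X)"
  by (rule finite_subset[of _ "Pow X"]) (auto simp: csets_def)

lemma csets_image:
  assumes inj: "inj_on f X" and iff: "\<And>u v. u \<in> X \<Longrightarrow> v \<in> X \<Longrightarrow> (u, v) \<in> E \<longleftrightarrow> (f u, f v) \<in> E'"
  shows "csets E' (f ` X) = image f ` csets E X"
proof (rule set_eqI, rule iffI)
  fix S assume S: "S \<in> csets E' (f ` X)"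
  define T where "T = {u \<in> X. f u \<in> S}"
  have ST: "S = f ` T" using S by (auto simp: T_def csets_def)
  have TX: "T \<subseteq> X" by (auto simp: T_def)
  let ?g = "inv_into X f"
  have g: "?g (f u) = u" if "u \<in> X" for u using inj that by simp
  have "conn_set E (?g ` S)"
  proof (rule conn_set_map)
    show "conn_set E' S" using S by (simp add: csets_def)
    fix p q assume "p \<in> S" "q \<in> S" "(p, q) \<in> E'"
    then obtain u v where "u \<in> T" "v \<in> T" "p = f u" "q = f v" using ST by blast
    then show "(?g p, ?g q) \<in> E" using iff g TX \<open>(p, q) \<in> E'\<close> by (metis subsetD)
  qed
  moreover have "?g ` S = T" unfolding ST image_image using g TX by force
  ultimately show "S \<in> image f ` csets E X" using ST TX by (auto simp: csets_def)
next
  fix S assume "S \<in> image f ` csets E X"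
  then obtain T where T: "T \<subseteq> X" "conn_set E T" "S = f ` T" by (auto simp: csets_def)
  have "conn_set E' (f ` T)" by (rule conn_set_map[OF T(2)]) (use T(1) iff in blast)
  then show "S \<in> csets E' (f ` X)" using T by (auto simp: csets_def)
qed

text \<open>
  The component \<open>P\<close> of \<open>b\<close> in \<open>B - S\<close> turns \<open>S\<close> into the pair \<open>(S \<union> P, P)\<close>, from which
  \<open>S\<close> is recovered as the difference.
\<close>

lemma card_csets_exchange:
  assumes "sym E" "finite B" "conn_set E B" "b \<in> B" "y \<in> B"
  shows "card {S \<in> csets E B. y \<in> S \<and> b \<notin> S}
    \<le> card {S \<in> csets E B. b \<in> S \<and> y \<in> S} * card {S \<in> csets E B. b \<in> S \<and> y \<notin> S}"
proof -
  define P where "P S = {v. (b, v) \<in> rtrancl_on (B - S) E}" for S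
  have P_sub: "P S \<subseteq> B - S" for S
    by (auto simp: P_def dest: in_rtrancl_on_in_F)
  let ?f = "\<lambda>S. (S \<union> P S, P S)"
  let ?X = "{S \<in> csets E B. y \<in> S \<and> b \<notin> S}"
  let ?Y = "{S \<in> csets E B. b \<in> S \<and> y \<in> S}" and ?Z = "{S \<in> csets E B. b \<in> S \<and> y \<notin> S}"
  have "?f S \<in> ?Y \<times> ?Z" if "S \<in> ?X" for S
  proof -
    have S: "S \<subseteq> B" "conn_set E S" "y \<in> S" "b \<notin> S" using that by (auto simp: csets_def)
    have bP: "b \<in> P S" using S assms by (simp add: P_def)
    have conn_P: "conn_set E (P S)"
      unfolding P_def by (rule conn_set_component) (use S assms in auto)
    have "y \<notin> P S" using P_sub S by blast
    obtain p q where pq: "p \<in> B" "p \<in> P S" "q \<in> B" "q \<notin> P S" "(p, q) \<in> E"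
      using conn_set_crossing[OF assms(3,4) bP assms(5) \<open>y \<notin> P S\<close>] by blast
    have "q \<in> S"
    proof (rule ccontr)
      assume "q \<notin> S"
      with pq have "q \<in> P S" by (auto simp: P_def intro: rtrancl_on_into_rtrancl_on)
      with pq show False by simp
    qed
    then have "conn_set E (S \<union> P S)"
      using conn_set_Un[OF assms(1) S(2) conn_P, of q p] pq assms(1) by (auto dest: symD)
    then show ?thesis using S P_sub[of S] bP conn_P by (auto simp: csets_def)
  qed
  moreover have "inj_on ?f ?X"
  proof (rule inj_onI)
    fix S T assume eq: "?f S = ?f T"
    have "S = (S \<union> P S) - P S" "T = (T \<union> P T) - P T" using P_sub by blast+
    with eq show "S = T" by auto
  qed
  ultimately have "card ?X \<le> card (?Y \<times> ?Z)"
    by (intro card_inj_on_le[where f = ?f]) (auto simp: assms finite_csets)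
  then show ?thesis by (simp add: card_cartesian_product)
qed

text \<open>Both members contain \<open>D\<close>, which covers the overlap, so intersecting the
  union with \<open>A\<close> and with \<open>B\<close> gives them back.\<close>

lemma inj_on_Un_pair:
  assumes "A \<inter> B \<subseteq> D"
    and "\<And>S. S \<in> X \<Longrightarrow> S \<subseteq> A \<and> D \<subseteq> S" "\<And>S. S \<in> Y \<Longrightarrow> S \<subseteq> B \<and> D \<subseteq> S"
  shows "inj_on (\<lambda>(S, T). S \<union> T) (X \<times> Y)"
proof (rule inj_onI)
  fix p q assume pq: "p \<in> X \<times> Y" "q \<in> X \<times> Y" and eq: "(\<lambda>(S, T). S \<union> T) p = (\<lambda>(S, T). S \<union> T) q"
  have recover: "S = (S \<union> T) \<inter> A" "T = (S \<union> T) \<inter> B" if "S \<in> X" "T \<in> Y" for S T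
    using assms(1) assms(2)[OF that(1)] assms(3)[OF that(2)] by blast+
  obtain S T S' T' where [simp]: "p = (S, T)" "q = (S', T')" by (cases p, cases q)
  have "S \<union> T = S' \<union> T'" using eq by simp
  then show "p = q" using recover[of S T] recover[of S' T'] pq by simp
qed

text \<open>Since \<open>h\<close> is a cut vertex, a connected set lies in \<open>A\<close>, or
  lies in \<open>B\<close> and avoids \<open>h\<close>, or is the union of one set from each side
  through \<open>h\<close>. Excluding \<open>{h}\<close> on the side of \<open>B\<close> keeps the
  third class disjoint from the first.\<close>

lemma card_csets_glue:
  assumes "sym E" "finite A" "finite B" "A \<inter> B = {h}"
    and no_edge: "\<And>u v. u \<in> A - {h} \<Longrightarrow> v \<in> B - {h} \<Longrightarrow> (u, v) \<notin> E"
  shows "card (csets E (A \<union> B)) = card (csets E A) + card {S \<in> csets E B. h \<notin> S}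
    + card {S \<in> csets E A. h \<in> S} * card {S \<in> csets E B. h \<in> S \<and> S \<noteq> {h}}"
proof -
  let ?X = "{S \<in> csets E A. h \<in> S}" and ?Y = "{S \<in> csets E B. h \<in> S \<and> S \<noteq> {h}}"
  let ?N = "{S \<in> csets E B. h \<notin> S}"
  let ?I = "(\<lambda>(S, T). S \<union> T) ` (?X \<times> ?Y)"
  have "csets E (A \<union> B) \<subseteq> csets E A \<union> ?N \<union> ?I"
  proof
    fix S assume S: "S \<in> csets E (A \<union> B)"
    then have conn: "conn_set E S" and sub: "S \<subseteq> A \<union> B" by (auto simp: csets_def)
    show "S \<in> csets E A \<union> ?N \<union> ?I"
    proof (cases "S \<subseteq> A \<or> (h \<notin> S \<and> S \<subseteq> B)")
      case True
      then show ?thesis using conn by (auto simp: csets_def)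
    next
      case False
      have "h \<in> S"
      proof (rule ccontr)
        assume h: "h \<notin> S"
        with False sub obtain u v where "u \<in> S" "u \<in> A" "v \<in> S" "v \<notin> A" by blast
        from conn_set_crossing[OF conn this] obtain p q
          where "p \<in> S" "p \<in> A" "q \<in> S" "q \<notin> A" "(p, q) \<in> E" .
        then show False using no_edge[of p q] h sub by blast
      qed
      have "conn_set E (S \<inter> A)"
        by (rule conn_set_retract[OF \<open>sym E\<close> conn, of h])
          (use \<open>h \<in> S\<close> assms(4) no_edge sub in blast)+
      moreover have "conn_set E (S \<inter> B)"
        by (rule conn_set_retract[OF \<open>sym E\<close> conn, of h])
          (use \<open>h \<in> S\<close> assms(1,4) no_edge sub in \<open>blast dest: symD\<close>)+
      moreover have "S = (S \<inter> A) \<union> (S \<inter> B)" using sub by blast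
      moreover have "S \<inter> B \<noteq> {h}" using False sub assms(4) by blast
      ultimately show ?thesis
        using \<open>h \<in> S\<close> assms(4) by (intro UnI2 image_eqI[of _ _ "(S \<inter> A, S \<inter> B)"]) (auto simp: csets_def)
    qed
  qed
  moreover have "?I \<subseteq> csets E (A \<union> B)"
    using conn_set_Un[OF assms(1)] by (fastforce simp: csets_def)
  moreover have "csets E A \<union> ?N \<subseteq> csets E (A \<union> B)" by (auto simp: csets_def)
  ultimately have eq: "csets E (A \<union> B) = csets E A \<union> ?N \<union> ?I" by blast
  have fin: "finite (csets E A)" "finite ?N" "finite ?I"
    using assms by (auto simp: finite_csets)
  have disj1: "csets E A \<inter> ?N = {}"
    using assms(4) by (auto simp: csets_def conn_set_def)
  have "T \<subseteq> A \<Longrightarrow> T \<in> ?Y \<Longrightarrow> False" for T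
    using assms(4) by (auto simp: csets_def)
  then have disj2: "(csets E A \<union> ?N) \<inter> ?I = {}"
    by (auto simp: csets_def)
  have "card ?I = card (?X \<times> ?Y)"
    by (rule card_image, rule inj_on_Un_pair[of A B "{h}"]) (use assms in \<open>auto simp: csets_def\<close>)
  then show ?thesis
    unfolding eq using card_Un_disjoint[OF _ fin(3) disj2] card_Un_disjoint[OF fin(1,2) disj1] fin
    by (simp add: card_cartesian_product)
qed

section \<open>Connected sets at a leaf\<close>

text \<open>Here \<open>K\<close> is the stationary part outside \<open>B\<close> and
  \<open>a\<close>, and \<open>C\<close> is the branch at \<open>w\<close> in the other direction of
  the path. Cancelling \<open>2 R M\<close> from the two counts leaves \<open>R (1 + N)\<close>
  against \<open>Y\<close>, and \<open>Y\<close> is at most \<open>M (1 + N)\<close>.\<close>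

lemma card_csets_leaf_less:
  assumes symE: "sym E" and fin: "finite K" "finite B" and conn_B: "conn_set E B"
    and verts: "a \<notin> K \<union> B" "K \<inter> B = {}" "w \<in> K" "b \<in> B" "x \<in> B" "y \<in> B" "x \<noteq> b" "x \<noteq> y"
    and edges: "(a, w) \<in> E" "(w, b) \<in> E" "(x, y) \<in> E"
    and edge_a: "\<And>v. v \<in> K \<union> B \<Longrightarrow> (a, v) \<in> E \<Longrightarrow> v = w"
    and edge_KB: "\<And>u v. u \<in> K \<Longrightarrow> v \<in> B \<Longrightarrow> (u, v) \<in> E \<Longrightarrow> u = w \<and> v = b"
    and edge_x: "\<And>v. v \<in> B \<Longrightarrow> (x, v) \<in> E \<Longrightarrow> v = y"
    and C: "C \<subseteq> K - {w}" "c \<in> C" "(w, c) \<in> E"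
    and le: "card {S \<in> csets E B. b \<in> S} \<le> card {S \<in> csets E C. c \<in> S}"
  shows "card {S \<in> csets E (insert a (K \<union> B)). x \<in> S} < card {S \<in> csets E (insert a (K \<union> B)). a \<in> S}"
proof -
  define R where "R = {S \<in> csets E K. w \<in> S}"
  define Y where "Y = {S \<in> csets E (B - {x}). y \<in> S}"
  define M where "M = {S \<in> csets E (B - {x}). b \<in> S \<and> y \<in> S}"
  define N where "N = {S \<in> csets E (B - {x}). b \<in> S \<and> y \<notin> S}"
  \<comment> \<open>These are connected sets of \<open>B\<close> through \<open>b\<close>, sorted by
    \<open>y\<close> and \<open>x\<close>. The leaf \<open>x\<close> can only join a set that
    already contains \<open>y\<close>.\<close>
  define F where "F = N \<union> M \<union> insert x ` M"
  have fins: "finite R" "finite Y" "finite M" "finite N" "finite F"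
    using fin by (auto simp: R_def Y_def M_def N_def F_def finite_csets)
  have symD: "(v, u) \<in> E" if "(u, v) \<in> E" for u v using symE that by (rule symD)

  have card_insert: "card (insert v ` X) = card X" if "\<And>S. S \<in> X \<Longrightarrow> v \<notin> S" for v and X :: "'a set set"
    by (rule card_image, rule inj_onI) (use that in \<open>metis insert_ident\<close>)
  have x_notin: "x \<notin> S" if "S \<in> M \<union> N \<union> Y" for S using that by (auto simp: M_def N_def Y_def csets_def)
  have card_F: "card F = card N + 2 * card M"
  proof -
    have "card F = card (N \<union> M) + card (insert x ` M)"
      unfolding F_def by (rule card_Un_disjoint) (use fins x_notin in auto)
    also have "card (N \<union> M) = card N + card M"
      by (rule card_Un_disjoint) (use fins in \<open>auto simp: M_def N_def\<close>)
    finally show ?thesis using card_insert[of M x] x_notin by simp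
  qed
  have F_sub: "F \<subseteq> {S \<in> csets E B. b \<in> S}"
  proof -
    have "conn_set E (insert x S)" if "S \<in> M" for S
      using conn_set_Un[OF symE conn_set_singleton[of E x], of S x y] that edges(3)
      by (auto simp: M_def csets_def)
    then show ?thesis using verts by (auto simp: F_def M_def N_def csets_def)
  qed

  \<comment> \<open>The set \<open>{w}\<close> and the sets of \<open>C\<close> through
    \<open>c\<close> enlarged by \<open>w\<close> are distinct members of \<open>R\<close>; the
    hypothesis \<open>le\<close> compares the latter with \<open>F\<close>.\<close>
  have card_R: "1 + card F \<le> card R"
  proof -
    let ?C = "{S \<in> csets E C. c \<in> S}"
    have "conn_set E (insert w S)" if "S \<in> ?C" for S
      using conn_set_Un[OF symE conn_set_singleton[of E w], of S w c] that C
      by (auto simp: csets_def)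
    then have sub: "insert {w} (insert w ` ?C) \<subseteq> R"
      using C verts by (auto simp: R_def csets_def conn_set_singleton)
    have fC: "finite ?C" using C fin by (auto intro!: finite_csets intro: finite_subset)
    have "card F \<le> card ?C"
      using card_mono[OF _ F_sub] le fin by (simp add: finite_csets)
    also have "card ?C = card (insert w ` ?C)"
    proof (rule card_insert[symmetric])
      show "w \<notin> S" if "S \<in> ?C" for S using that C by (auto simp: csets_def)
    qed
    finally have "1 + card F \<le> 1 + card (insert w ` ?C)" by simp
    also have "\<dots> = card (insert {w} (insert w ` ?C))"
      using fC C by (subst card_insert_disjoint) (auto simp: csets_def)
    also have "\<dots> \<le> card R" by (rule card_mono[OF fins(1) sub])
    finally show ?thesis .
  qed

  \<comment> \<open>Besides \<open>{a}\<close>, take \<open>a\<close> with a member of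
    \<open>R\<close> and optionally a member of \<open>F\<close>; the added empty set stands for not
    entering \<open>B\<close>.\<close>
  have lower: "1 + card R * (1 + card F) \<le> card {S \<in> csets E (insert a (K \<union> B)). a \<in> S}"
  proof -
    let ?R = "insert a ` R"
    let ?L = "(\<lambda>(S, T). S \<union> T) ` (?R \<times> insert {} F)"
    have R_conn: "conn_set E (insert a S)" if "S \<in> R" for S
      using conn_set_Un[OF symE conn_set_singleton[of E a], of S a w] that edges(1)
      by (auto simp: R_def csets_def)
    have RF_conn: "conn_set E (insert a S \<union> T)" if "S \<in> R" "T \<in> F" for S T
      by (rule conn_set_Un[OF symE R_conn[OF that(1)], of T w b])
        (use that F_sub edges in \<open>auto simp: R_def csets_def\<close>)
    have "insert {a} ?L \<subseteq> {S \<in> csets E (insert a (K \<union> B)). a \<in> S}"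
      using R_conn RF_conn F_sub by (force simp: csets_def R_def conn_set_singleton)
    moreover have "finite {S \<in> csets E (insert a (K \<union> B)). a \<in> S}"
      using fin by (simp add: finite_csets)
    ultimately have "card (insert {a} ?L) \<le> card {S \<in> csets E (insert a (K \<union> B)). a \<in> S}"
      by (rule card_mono[rotated])
    moreover have "{a} \<notin> ?L" using verts by (auto simp: R_def)
    moreover have "card ?L = card R * (1 + card F)"
    proof -
      have "card ?L = card (?R \<times> insert {} F)"
      proof (rule card_image, rule inj_on_Un_pair[of "insert a K" B "{}"])
        show "insert a K \<inter> B \<subseteq> {}" using verts by blast
      qed (use F_sub in \<open>auto simp: R_def csets_def\<close>)
      moreover have "{} \<notin> F" using F_sub by auto
      moreover have "card ?R = card R" 
        by (rule card_insert) (use verts in \<open>auto simp: R_def csets_def\<close>)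
      ultimately show ?thesis using fins by (simp add: card_cartesian_product)
    qed
    ultimately show ?thesis using fins by simp
  qed

  \<comment> \<open>A set through \<open>x\<close> is \<open>{x}\<close>, or stays in
    \<open>B\<close> and gives a member of \<open>Y\<close>, or leaves \<open>B\<close> along the
    edge from \<open>b\<close> to \<open>w\<close>. In the last case it splits into members of
    \<open>R\<close> and \<open>M\<close>, and the choice of containing \<open>a\<close> accounts
    for the factor 2.\<close>
  have upper: "card {S \<in> csets E (insert a (K \<union> B)). x \<in> S} \<le> 1 + card Y + 2 * card R * card M"
  proof -
    let ?R = "R \<union> insert a ` R" and ?M = "insert x ` M"
    let ?I = "(\<lambda>(S, T). S \<union> T) ` (?R \<times> ?M)"
    let ?U = "{{x}} \<union> insert x ` Y \<union> ?I"
    have "{S \<in> csets E (insert a (K \<union> B)). x \<in> S} \<subseteq> ?U"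
    proof clarify
      fix S assume S: "S \<in> csets E (insert a (K \<union> B))" "x \<in> S" and *: "S \<notin> ?I" "S \<notin> insert x ` Y"
      have sub: "S \<subseteq> insert a (K \<union> B)" and conn: "conn_set E S" using S by (auto simp: csets_def)
      have nbr_x: "v = y" if "(x, v) \<in> E" "v \<in> S" for v
      proof -
        have "v \<noteq> a" using edge_a symD that verts by (metis IntI UnCI empty_iff)
        moreover have "v \<notin> K" using edge_KB symD that verts by blast
        ultimately show ?thesis using that sub edge_x by blast
      qed
      show "S = {x}"
      proof (rule ccontr)
        assume "S \<noteq> {x}"
        then obtain v where "v \<in> S" "v \<notin> {x}" using \<open>x \<in> S\<close> by blast
        from conn_set_crossing[OF conn \<open>x \<in> S\<close> _ this] nbr_x have yS: "y \<in> S" by blast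
        \<comment> \<open>A leaf can be removed without disconnecting the set.\<close>
        have conn_x: "conn_set E (S - {x})"
          by (rule conn_set_retract[OF symE conn, of y]) (use nbr_x symD yS verts in blast)+
        show False
        proof (cases "S \<subseteq> B")
          case True
          then have "S - {x} \<in> Y" using conn_x yS verts by (auto simp: Y_def csets_def)
          moreover have "S = insert x (S - {x})" using S by blast
          ultimately show False using *(2) by blast
        next
          case False
          then obtain v where "v \<in> S" "v \<notin> B" by blast
          from conn_set_crossing[OF conn \<open>x \<in> S\<close> verts(5) this] obtain p q
            where pq: "p \<in> S" "p \<in> B" "q \<in> S" "q \<notin> B" "(p, q) \<in> E" .
          \<comment> \<open>The only neighbour of \<open>a\<close> here is \<open>w\<close>, which
            is not in \<open>B\<close>, so the edge leaving \<open>B\<close> must enter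
            \<open>K\<close>.\<close>
          have "q \<noteq> a" using edge_a symD pq verts by blast
          then have "q \<in> K" using pq sub by blast
          then have wb: "w \<in> S" "b \<in> S" using edge_KB[of q p] symD pq by blast+
          have "conn_set E (S \<inter> K)"
          proof (rule conn_set_retract[OF symE conn, of w])
            fix u v assume "u \<in> S \<inter> K" "v \<in> S - S \<inter> K" "(u, v) \<in> E"
            then show "u = w" using edge_a edge_KB symD sub by blast
          qed (use wb verts in auto)
          then have R: "S \<inter> K \<in> R" using wb verts by (simp add: R_def csets_def)
          have "conn_set E ((S - {x}) \<inter> B)"
          proof (rule conn_set_retract[OF symE conn_x, of b])
            fix u v assume "u \<in> (S - {x}) \<inter> B" "v \<in> S - {x} - (S - {x}) \<inter> B" "(u, v) \<in> E"
            then show "u = b" using edge_a[of u] edge_KB[of v u] symD sub verts by blast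
          qed (use wb verts in auto)
          moreover have "(S - {x}) \<inter> B = S \<inter> B - {x}" by blast
          ultimately have M: "S \<inter> B - {x} \<in> M" using wb verts yS
            by (auto simp: M_def csets_def)
          define S\<^sub>1 where "S\<^sub>1 = (if a \<in> S then insert a (S \<inter> K) else S \<inter> K)"
          define S\<^sub>2 where "S\<^sub>2 = insert x (S \<inter> B - {x})"
          have "S = (\<lambda>(S, T). S \<union> T) (S\<^sub>1, S\<^sub>2)"
            using sub \<open>x \<in> S\<close> verts by (auto simp: S\<^sub>1_def S\<^sub>2_def)
          moreover have "S\<^sub>1 \<in> ?R" using R by (simp add: S\<^sub>1_def)
          moreover have "S\<^sub>2 \<in> ?M" unfolding S\<^sub>2_def using M by (rule imageI)
          ultimately have "S \<in> ?I" using image_eqI[of S _ "(S\<^sub>1, S\<^sub>2)" "?R \<times> ?M"] by blast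
          then show False using *(1) by blast
        qed
      qed
    qed
    moreover have "finite ?U" using fins by simp
    ultimately have "card {S \<in> csets E (insert a (K \<union> B)). x \<in> S} \<le> card ?U"
      by (rule card_mono[rotated])
    also have "\<dots> \<le> card ({{x}} \<union> insert x ` Y) + card ?I" by (rule card_Un_le)
    also have "card ({{x}} \<union> insert x ` Y) \<le> 1 + card Y"
      using card_Un_le[of "{{x}}" "insert x ` Y"] card_image_le[OF fins(2), of "insert x"] by simp
    also have "card ?I \<le> card (?R \<times> ?M)" by (rule card_image_le) (use fins in simp)
    also have "card (?R \<times> ?M) = card ?R * card ?M" by (rule card_cartesian_product)
    also have "\<dots> \<le> (2 * card R) * card M"
    proof (rule mult_mono)
      show "card ?R \<le> 2 * card R"
        using card_Un_le[of R "insert a ` R"] card_image_le[OF fins(1), of "insert a"] by simp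
    qed (use card_image_le[OF fins(3), of "insert x"] in simp_all)
    finally show ?thesis by simp
  qed

  \<comment> \<open>Members of \<open>Y\<close> containing \<open>b\<close> form \<open>M\<close>;
    the others are bounded by the exchange argument in \<open>B - {x}\<close>.\<close>
  have card_Y: "card Y \<le> card M + card M * card N"
  proof -
    have "conn_set E (B - {x})"
      by (rule conn_set_retract[OF symE conn_B, of y]) (use edge_x symD verts in blast)+
    then have "card {S \<in> csets E (B - {x}). y \<in> S \<and> b \<notin> S} \<le> card M * card N"
      unfolding M_def N_def
      using card_csets_exchange[OF symE, of "B - {x}" b y] fin verts by blast
    moreover have "Y = M \<union> {S \<in> csets E (B - {x}). y \<in> S \<and> b \<notin> S}" by (auto simp: Y_def M_def)
    ultimately show ?thesis using card_Un_le[of M "{S \<in> csets E (B - {x}). y \<in> S \<and> b \<notin> S}"] by simp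
  qed

  have "card M < card R" using card_R card_F by simp
  then have "card M * (1 + card N) < card R * (1 + card N)" by (rule mult_less_mono1) simp
  then have "1 + card Y + 2 * card R * card M < 1 + card R * (1 + card F)"
    using card_Y unfolding card_F by (simp add: algebra_simps)
  with upper lower show ?thesis by linarith
qed

section \<open>Moving branches\<close>

text \<open>For symmetric irreflexive relations this says that there is no undirected cycle.\<close>

definition acyc :: "'a rel \<Rightarrow> bool" where
  "acyc E \<longleftrightarrow> (\<forall>w a b. (w, a) \<in> E \<longrightarrow> (w, b) \<in> E \<longrightarrow> a \<noteq> b \<longrightarrow> (a, b) \<notin> rtrancl_on (- {w}) E)"

lemma acycD: "acyc E \<Longrightarrow> (w, a) \<in> E \<Longrightarrow> (w, b) \<in> E \<Longrightarrow> (a, b) \<in> rtrancl_on (- {w}) E \<Longrightarrow> a = b"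
  by (auto simp: acyc_def)

lemma acyc_mono: "acyc E \<Longrightarrow> F \<subseteq> E \<Longrightarrow> acyc F"
  unfolding acyc_def by (meson order_refl rtrancl_on_mono subsetD)

section \<open>Acyclicity under renaming and gluing\<close>

lemma acyc_image:
  fixes f :: "'a \<Rightarrow> 'a"
  assumes "bij f" "acyc E"
  shows "acyc (map_prod f f ` E)"
  unfolding acyc_def
proof (intro allI impI notI)
  fix w a b
  assume *: "(w, a) \<in> map_prod f f ` E" "(w, b) \<in> map_prod f f ` E" "a \<noteq> b"
    "(a, b) \<in> rtrancl_on (- {w}) (map_prod f f ` E)"
  have inv: "inv f (f z) = z" "f (inv f z) = z" for z
    using \<open>bij f\<close> by (simp_all add: bij_is_inj bij_is_surj surj_f_inv_f)
  have E: "(inv f p, inv f q) \<in> E" if "(p, q) \<in> map_prod f f ` E" for p q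
    using that inv by auto
  have "(inv f a, inv f b) \<in> rtrancl_on (- {inv f w}) E"
    by (rule rtrancl_on_map[OF *(4)]) (use E inv in \<open>metis ComplD ComplI singletonD singletonI\<close>)+
  then show False using acycD[OF assms(2) E[OF *(1)] E[OF *(2)]] *(3) inv(2) by metis
qed

text \<open>A cycle using both sides would have to pass through \<open>h\<close> twice. The
  auxiliary facts quantify over both relations and both sets so that they can also be used with the
  sides exchanged.\<close>

lemma acyc_Un:
  assumes E: "E\<^sub>1 \<subseteq> A \<times> A" "E\<^sub>2 \<subseteq> B \<times> B" "A \<inter> B = {h}" and acyc: "acyc E\<^sub>1" "acyc E\<^sub>2"
  shows "acyc (E\<^sub>1 \<union> E\<^sub>2)"
proof -
  \<comment> \<open>A walk that avoids \<open>h\<close> cannot cross from one side to the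
    other.\<close>
  have stay: "q \<in> A \<and> (p, q) \<in> rtrancl_on (- {h}) E\<^sub>1"
    if "(p, q) \<in> rtrancl_on (- {h}) (E\<^sub>1 \<union> E\<^sub>2)" "p \<in> A"
      "E\<^sub>1 \<subseteq> A \<times> A" "E\<^sub>2 \<subseteq> B \<times> B" "A \<inter> B = {h}" for p q E\<^sub>1 E\<^sub>2 and A B :: "'a set"
    using that
  proof (induction rule: rtrancl_on_induct)
    case base
    then show ?case by simp
  next
    case (step q r)
    then have "(q, r) \<in> E\<^sub>1" "r \<in> A" by blast+
    with step show ?case by (blast intro: rtrancl_on_into_rtrancl_on)
  qed
  have same: "p = q"
    if "(w, p) \<in> E\<^sub>1" "(w, q) \<in> E\<^sub>1" "(p, q) \<in> rtrancl_on (- {w}) (E\<^sub>1 \<union> E\<^sub>2)"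
      "E\<^sub>1 \<subseteq> A \<times> A" "E\<^sub>2 \<subseteq> B \<times> B" "A \<inter> B = {h}" "acyc E\<^sub>1" for w p q E\<^sub>1 E\<^sub>2 and A B :: "'a set"
  proof (cases "w = h")
    case True
    then show ?thesis using stay[of p q E\<^sub>1 E\<^sub>2 A B] acycD[of E\<^sub>1 w p q] that by blast
  next
    case False
    \<comment> \<open>Contracting the other side to \<open>h\<close> gives a walk in
      \<open>A\<close> alone, which still avoids \<open>w\<close> because \<open>w\<close> is not
      \<open>h\<close>.\<close>
    let ?f = "\<lambda>z. if z \<in> A then z else h"
    have f_h: "?f z = h" if "z \<in> B" for z using that \<open>A \<inter> B = {h}\<close> by auto
    have "(?f p, ?f q) \<in> rtrancl_on (- {w}) E\<^sub>1"
    proof (rule rtrancl_on_map[OF that(3)])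
      fix r s assume "(r, s) \<in> E\<^sub>1 \<union> E\<^sub>2"
      then show "?f r = ?f s \<or> (?f r, ?f s) \<in> E\<^sub>1"
      proof
        assume "(r, s) \<in> E\<^sub>1"
        moreover from this have "r \<in> A" "s \<in> A" using that(4) by blast+
        ultimately show ?thesis by simp
      next
        assume "(r, s) \<in> E\<^sub>2"
        then have "?f r = h" "?f s = h" using that(5) f_h by blast+
        then show ?thesis by simp
      qed
    qed (use False in auto)
    moreover have "p \<in> A" "q \<in> A" using that by blast+
    ultimately show ?thesis using acycD[of E\<^sub>1 w p q] that by simp
  qed
  have diff: False
    if "(w, p) \<in> E\<^sub>1" "(w, q) \<in> E\<^sub>2" "(p, q) \<in> rtrancl_on (- {w}) (E\<^sub>1 \<union> E\<^sub>2)"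
      "E\<^sub>1 \<subseteq> A \<times> A" "E\<^sub>2 \<subseteq> B \<times> B" "A \<inter> B = {h}" for w p q E\<^sub>1 E\<^sub>2 and A B :: "'a set"
  proof -
    \<comment> \<open>Edges of both kinds leave \<open>w\<close>, so \<open>w\<close> is the common
      vertex; the walk from \<open>p\<close> avoids it and could never reach
      \<open>B\<close>.\<close>
    have "w = h" "p \<in> A" "q \<in> B" using that by blast+
    moreover from this have "q \<noteq> h" using in_rtrancl_on_in_F[OF that(3)] by blast
    ultimately show False using stay[of p q E\<^sub>1 E\<^sub>2 A B] that by blast
  qed
  have swap: "E\<^sub>2 \<union> E\<^sub>1 = E\<^sub>1 \<union> E\<^sub>2" "B \<inter> A = {h}" using E by blast+
  show ?thesis
    unfolding acyc_def
  proof (intro allI impI notI)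
    fix w p q
    assume *: "(w, p) \<in> E\<^sub>1 \<union> E\<^sub>2" "(w, q) \<in> E\<^sub>1 \<union> E\<^sub>2" "p \<noteq> q"
      "(p, q) \<in> rtrancl_on (- {w}) (E\<^sub>1 \<union> E\<^sub>2)"
    from *(1,2) consider "(w, p) \<in> E\<^sub>1" "(w, q) \<in> E\<^sub>1" | "(w, p) \<in> E\<^sub>2" "(w, q) \<in> E\<^sub>2"
      | "(w, p) \<in> E\<^sub>1" "(w, q) \<in> E\<^sub>2" | "(w, p) \<in> E\<^sub>2" "(w, q) \<in> E\<^sub>1" by blast
    then show False
    proof cases
      case 1 then show ?thesis using same[of w p E\<^sub>1 q E\<^sub>2 A B] * E acyc by blast
    next
      case 2 then show ?thesis using same[of w p E\<^sub>2 q E\<^sub>1 B A] * E acyc swap by simp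
    next
      case 3 then show ?thesis using diff[of w p E\<^sub>1 q E\<^sub>2 A B] * E by blast
    next
      case 4 then show ?thesis using diff[of w p E\<^sub>2 q E\<^sub>1 B A] * E swap by simp
    qed
  qed
qed

text \<open>The branches of \<open>a\<close> outside \<open>V\<^sub>0\<close>, which make up \<open>G\<close>, are moved to \<open>x\<close>.\<close>

locale branch_move =
  fixes E :: "'a rel" and V\<^sub>0 G :: "'a set" and a x :: 'a
  assumes symE: "sym E" and irreflE: "irrefl E" and E_sub: "E \<subseteq> (V\<^sub>0 \<union> G) \<times> (V\<^sub>0 \<union> G)"
    and conn: "conn_set E (V\<^sub>0 \<union> G)" and acycE: "acyc E"
    and finV: "finite V\<^sub>0" "finite G" and disj: "V\<^sub>0 \<inter> G = {}" and G_ne: "G \<noteq> {}"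
    and a: "a \<in> V\<^sub>0" and x: "x \<in> V\<^sub>0"
    and attach: "\<And>u v. u \<in> V\<^sub>0 \<Longrightarrow> v \<in> G \<Longrightarrow> (u, v) \<in> E \<Longrightarrow> u = a"
begin

abbreviation "\<tau> \<equiv> transpose a x"

text \<open>Renaming by the transposition makes the moved part an isomorphic copy attached at
  \<open>x\<close>, while nothing changes inside \<open>V\<^sub>0\<close>.\<close>

definition E' :: "'a rel" where
  "E' = (E \<inter> V\<^sub>0 \<times> V\<^sub>0) \<union> map_prod \<tau> \<tau> ` (E \<inter> insert a G \<times> insert a G)"

lemma no_loop: "(v, v) \<notin> E"
  using irreflE by (simp add: irrefl_def)

lemma \<tau>_G: "v \<in> G \<Longrightarrow> \<tau> v = v"
  using a x disj by (auto simp: transpose_def)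

lemma \<tau>_image: "\<tau> ` insert a G = insert x G"
  using \<tau>_G by force

text \<open>Membership in the image is membership of the preimage, because \<open>\<tau>\<close> is
  its own inverse.\<close>

lemma E'_iff:
  "(u, v) \<in> E' \<longleftrightarrow> (u, v) \<in> E \<and> u \<in> V\<^sub>0 \<and> v \<in> V\<^sub>0
    \<or> (\<tau> u, \<tau> v) \<in> E \<and> \<tau> u \<in> insert a G \<and> \<tau> v \<in> insert a G"
proof -
  have "(u, v) = map_prod \<tau> \<tau> (\<tau> u, \<tau> v)" by simp
  then have "(u, v) \<in> map_prod \<tau> \<tau> ` X \<longleftrightarrow> (\<tau> u, \<tau> v) \<in> X" for X
    using image_eqI[of "(u, v)" "map_prod \<tau> \<tau>" "(\<tau> u, \<tau> v)" X] by auto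
  then show ?thesis by (auto simp: E'_def)
qed

lemma sym_E': "sym E'"
  by (rule symI) (use symE in \<open>auto simp: E'_iff dest: symD\<close>)

lemma \<tau>_mem: "\<tau> v \<in> insert a G \<longleftrightarrow> v \<in> insert x G"
  using \<tau>_image by (metis image_iff transpose_involutory)

lemma E'_sub: "E' \<subseteq> (V\<^sub>0 \<union> G) \<times> (V\<^sub>0 \<union> G)"
  using x by (auto simp only: E'_iff \<tau>_mem)

lemma acyc_E': "acyc E'"
  unfolding E'_def
proof (rule acyc_Un)
  show "map_prod \<tau> \<tau> ` (E \<inter> insert a G \<times> insert a G) \<subseteq> insert x G \<times> insert x G"
    using \<tau>_image by force
  show "V\<^sub>0 \<inter> insert x G = {x}" using disj x by blast
  show "acyc (map_prod \<tau> \<tau> ` (E \<inter> insert a G \<times> insert a G))"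
    by (rule acyc_image[OF bij_transpose]) (rule acyc_mono[OF acycE], simp)
qed (use acyc_mono[OF acycE] in simp_all)

lemma conn_V\<^sub>0: "conn_set E V\<^sub>0"
  by (rule conn_set_retract[OF symE conn, of a]) (use a attach in auto)

lemma conn_G: "conn_set E (insert a G)"
  by (rule conn_set_retract[OF symE conn, of a]) (use a disj attach symE in \<open>auto dest: symD\<close>)

lemma conn_E': "conn_set E' (V\<^sub>0 \<union> G)"
proof -
  have "conn_set E' (id ` V\<^sub>0)"
    by (rule conn_set_map[OF conn_V\<^sub>0]) (simp add: E'_iff)
  moreover have "conn_set E' (\<tau> ` insert a G)"
    by (rule conn_set_map[OF conn_G]) (simp add: E'_iff)
  then have "conn_set E' (insert x G)" unfolding \<tau>_image .
  ultimately have "conn_set E' (V\<^sub>0 \<union> insert x G)"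
    using conn_set_Un[OF sym_E', of V\<^sub>0 "insert x G" x x] x by simp
  then show ?thesis using x by (simp add: insert_absorb)
qed

text \<open>The vertex \<open>x\<close> keeps its neighbour \<open>y\<close> and gains those of
  \<open>a\<close> in \<open>G\<close>, while \<open>a\<close> keeps only \<open>w\<close>. So
  \<open>a\<close> and \<open>x\<close> exchange degrees, and all other degrees stay the
  same.\<close>

lemma degree_E':
  assumes leaf_x: "E `` {x} = {y}" and nbr_a: "E `` {a} \<inter> V\<^sub>0 = {w}"
    and "y \<in> V\<^sub>0" "x \<noteq> a"
  shows "card (E' `` {v}) = card (E `` {\<tau> v})"
proof -
  have nbr_V0: "u \<in> V\<^sub>0 \<or> v = a" if "(v, u) \<in> E" "v \<in> V\<^sub>0" for u v
    using that attach E_sub by blast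
  have nbr_G: "u \<in> insert a G" if "(v, u) \<in> E" "v \<in> G" for u v
    using that attach E_sub symE by (blast dest: symD)
  consider "v = x" | "v = a" | "v \<in> G" | "v \<notin> G" "v \<noteq> x" "v \<noteq> a" by blast
  then show ?thesis
  proof cases
    case 1
    have "E' `` {x} = insert y (E `` {a} \<inter> G)"
    proof (rule set_eqI)
      fix u
      have "\<tau> u \<in> insert a G \<and> (a, \<tau> u) \<in> E \<longleftrightarrow> u \<in> G \<and> (a, u) \<in> E"
        unfolding \<tau>_mem using \<tau>_G no_loop by auto
      then show "u \<in> E' `` {x} \<longleftrightarrow> u \<in> insert y (E `` {a} \<inter> G)"
        using leaf_x x \<open>y \<in> V\<^sub>0\<close> by (auto simp: E'_iff)
    qed
    moreover have "E `` {a} = insert w (E `` {a} \<inter> G)"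
      using nbr_a E_sub by blast
    moreover have "y \<notin> G" "w \<notin> G" using assms disj by blast+
    ultimately show ?thesis using 1 finV(2) by (metis card_insert_disjoint finite_Int IntD2 transpose_apply_second)
  next
    case 2
    have "u \<in> E' `` {a} \<longleftrightarrow> u = w" for u
    proof -
      have "\<tau> a \<notin> insert a G" using assms(4) x disj by auto
      then show ?thesis using nbr_a a by (auto simp: E'_iff)
    qed
    then have "E' `` {a} = {w}" by blast
    then show ?thesis using 2 leaf_x by simp
  next
    case 3
    have "E' `` {v} = \<tau> ` (E `` {v})"
    proof (rule set_eqI)
      fix u
      have "u \<in> E' `` {v} \<longleftrightarrow> (v, \<tau> u) \<in> E"
        using 3 disj \<tau>_G nbr_G by (auto simp: E'_iff)
      also have "\<dots> \<longleftrightarrow> u \<in> \<tau> ` (E `` {v})"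
        using imageI[of "\<tau> u" "E `` {v}" \<tau>] by auto
      finally show "u \<in> E' `` {v} \<longleftrightarrow> u \<in> \<tau> ` (E `` {v})" .
    qed
    then show ?thesis using 3 \<tau>_G by (simp add: card_image)
  next
    case 4
    then have "\<tau> v = v" by simp
    moreover have "v \<in> V\<^sub>0 \<and> u \<in> V\<^sub>0" if "(v, u) \<in> E" for u
      using that 4 nbr_V0 E_sub by blast
    then have "E' `` {v} = E `` {v}"
      using 4 \<open>\<tau> v = v\<close> by (auto simp: E'_iff)
    ultimately show ?thesis by simp
  qed
qed

text \<open>Gluing is counted at \<open>a\<close> before the move and at \<open>x\<close> after it.
  The two formulas differ only in the number of sets of \<open>V\<^sub>0\<close> through the
  attaching vertex, which multiplies the positive number \<open>?q\<close>.\<close>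

lemma card_csets_E':
  assumes less: "card {S \<in> csets E V\<^sub>0. x \<in> S} < card {S \<in> csets E V\<^sub>0. a \<in> S}"
    and edge: "(a, w) \<in> E" "w \<in> V\<^sub>0"
  shows "card (csets E' (V\<^sub>0 \<union> G)) < card (csets E (V\<^sub>0 \<union> G))"
proof -
  let ?q = "card {S \<in> csets E (insert a G). a \<in> S \<and> S \<noteq> {a}}"
  have "csets E' (id ` V\<^sub>0) = image id ` csets E V\<^sub>0"
  proof (rule csets_image)
    fix u v assume uv: "u \<in> V\<^sub>0" "v \<in> V\<^sub>0"
    \<comment> \<open>Both vertices would have to be \<open>x\<close>, and the edge a loop.\<close>
    have "(\<tau> u, \<tau> v) \<notin> E" if "\<tau> u \<in> insert a G" "\<tau> v \<in> insert a G"
      using that uv disj no_loop unfolding \<tau>_mem by auto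
    then show "(u, v) \<in> E \<longleftrightarrow> (id u, id v) \<in> E'" using uv by (auto simp: E'_iff)
  qed simp
  then have V0: "csets E' V\<^sub>0 = csets E V\<^sub>0" by simp

  have "csets E' (\<tau> ` insert a G) = image \<tau> ` csets E (insert a G)"
  proof (rule csets_image)
    fix u v assume uv: "u \<in> insert a G" "v \<in> insert a G"
    have "(\<tau> u, \<tau> v) \<notin> E" if "\<tau> u \<in> V\<^sub>0" "\<tau> v \<in> V\<^sub>0"
      using that uv disj no_loop \<tau>_G by auto
    then show "(u, v) \<in> E \<longleftrightarrow> (\<tau> u, \<tau> v) \<in> E'" using uv by (auto simp: E'_iff)
  qed (rule inj_on_subset[OF bij_is_inj[OF bij_transpose]], simp)
  then have G: "csets E' (insert x G) = image \<tau> ` csets E (insert a G)" unfolding \<tau>_image .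
  have inj: "inj_on (image \<tau>) X" for X by (rule inj_onI) (metis bij_is_inj bij_transpose inj_image_eq_iff)
  have x_img: "x \<in> \<tau> ` S \<longleftrightarrow> a \<in> S" for S
    by (metis bij_is_inj bij_transpose inj_image_mem_iff transpose_apply_first)
  have "{S \<in> csets E' (insert x G). x \<notin> S} = image \<tau> ` {S \<in> csets E (insert a G). a \<notin> S}"
    unfolding G using x_img by auto
  then have G_without: "card {S \<in> csets E' (insert x G). x \<notin> S} = card {S \<in> csets E (insert a G). a \<notin> S}"
    by (simp add: card_image[OF inj])
  have "\<tau> ` S = {x} \<longleftrightarrow> S = {a}" for S
    by (metis bij_is_inj bij_transpose image_empty image_insert inj_image_eq_iff transpose_apply_first)
  then have "{S \<in> csets E' (insert x G). x \<in> S \<and> S \<noteq> {x}}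
      = image \<tau> ` {S \<in> csets E (insert a G). a \<in> S \<and> S \<noteq> {a}}"
    unfolding G using x_img by auto
  then have G_with: "card {S \<in> csets E' (insert x G). x \<in> S \<and> S \<noteq> {x}} = ?q"
    by (simp add: card_image[OF inj])

  \<comment> \<open>The whole moved part witnesses that \<open>?q\<close> is positive, which makes
    the decrease strict.\<close>
  have "insert a G \<in> {S \<in> csets E (insert a G). a \<in> S \<and> S \<noteq> {a}}"
    using conn_G G_ne a disj by (auto simp: csets_def)
  then have "?q > 0"
    using finV by (subst card_gt_0_iff) (auto simp: finite_csets)

  have "card (csets E (V\<^sub>0 \<union> insert a G)) = card (csets E V\<^sub>0)
      + card {S \<in> csets E (insert a G). a \<notin> S} + card {S \<in> csets E V\<^sub>0. a \<in> S} * ?q"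
    by (rule card_csets_glue[OF symE]) (use finV a disj attach in auto)
  moreover have "card (csets E' (V\<^sub>0 \<union> insert x G)) = card (csets E' V\<^sub>0)
      + card {S \<in> csets E' (insert x G). x \<notin> S}
      + card {S \<in> csets E' V\<^sub>0. x \<in> S} * card {S \<in> csets E' (insert x G). x \<in> S \<and> S \<noteq> {x}}"
  proof (rule card_csets_glue[OF sym_E'])
    fix u v assume "u \<in> V\<^sub>0 - {x}" "v \<in> insert x G - {x}"
    then have "v \<notin> V\<^sub>0" "u \<notin> insert x G" using disj by blast+
    then show "(u, v) \<notin> E'" unfolding E'_iff \<tau>_mem by blast
  qed (use finV x disj in auto)
  moreover have "V\<^sub>0 \<union> insert a G = V\<^sub>0 \<union> G" "V\<^sub>0 \<union> insert x G = V\<^sub>0 \<union> G" using a x by blast+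
  ultimately show ?thesis
    using mult_less_mono1[OF less \<open>?q > 0\<close>] by (simp add: V0 G_without G_with)
qed

end

section \<open>Longest paths in trees\<close>

locale tree_rel =
  fixes E :: "'a rel" and V :: "'a set"
  assumes sym_E: "sym E" and irrefl_E: "irrefl E" and E_sub: "E \<subseteq> V \<times> V" and fin: "finite V"
    and conn_V: "conn_set E V" and acyc_E: "acyc E"
begin

lemma E_sym: "(u, v) \<in> E \<Longrightarrow> (v, u) \<in> E"
  using sym_E by (rule symD)

lemma E_irrefl: "(u, v) \<in> E \<Longrightarrow> u \<noteq> v"
  using irrefl_E by (auto simp: irrefl_def)

definition path :: "'a list \<Rightarrow> bool" where
  "path p \<longleftrightarrow> p \<noteq> [] \<and> distinct p \<and> set p \<subseteq> V \<and> successively (\<lambda>u v. (u, v) \<in> E) p"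

lemma path_rev: "path (rev p) \<longleftrightarrow> path p"
proof -
  have "successively (\<lambda>u v. (v, u) \<in> E) p = successively (\<lambda>u v. (u, v) \<in> E) p"
    by (rule arg_cong[of _ _ "\<lambda>r. successively r p"]) (use E_sym in blast)
  then show ?thesis by (simp add: path_def)
qed

lemma conn_set_path: "p \<noteq> [] \<Longrightarrow> successively (\<lambda>u v. (u, v) \<in> E) p \<Longrightarrow> conn_set E (set p)"
proof (induction p)
  case (Cons u p)
  show ?case
  proof (cases "p = []")
    case True
    then show ?thesis by (simp add: conn_set_singleton)
  next
    case False
    then show ?thesis
      using conn_set_Un[OF sym_E conn_set_singleton[of E u], of "set p" u "hd p"] Cons
      by (auto simp: successively_Cons)
  qed
qed simp

lemma path_walk:
  assumes "successively (\<lambda>u v. (u, v) \<in> E) p" "u \<in> set p" "v \<in> set p" "set p \<subseteq> F"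
  shows "(u, v) \<in> rtrancl_on F E"
  using conn_set_path[of p] assms rtrancl_on_mono[of E E "set p" F u v]
  by (cases "p = []") (auto simp: conn_set_def)

definition longest :: "'a list \<Rightarrow> bool" where
  "longest p \<longleftrightarrow> path p \<and> (\<forall>q. path q \<longrightarrow> length q \<le> length p)"

lemma longest_rev: "longest p \<Longrightarrow> longest (rev p)"
  by (simp add: longest_def path_rev)

lemma longest_exists: "\<exists>p. longest p"
proof -
  obtain v where "v \<in> V" using conn_V by (auto simp: conn_set_def)
  then have "path [v]" by (simp add: path_def)
  moreover have "length q < Suc (card V)" if "path q" for q
    using that fin by (metis path_def card_mono distinct_card le_imp_less_Suc)
  ultimately show ?thesis
    unfolding longest_def using ex_has_greatest_nat[of path "[v]" length "Suc (card V)"] by blast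
qed

text \<open>A second neighbour of \<open>x\<close> would close a cycle if it lay on the path and
  would prolong the path if it did not.\<close>

lemma longest_end_leaf:
  assumes "longest (p @ [y, x])"
  shows "E `` {x} = {y}"
proof -
  have path: "path (p @ [y, x])" using assms by (simp add: longest_def)
  then have yx: "(y, x) \<in> E" by (auto simp: path_def successively_append_iff successively_Cons)
  have "z = y" if xz: "(x, z) \<in> E" for z
  proof (rule ccontr)
    assume "z \<noteq> y"
    show False
    proof (cases "z \<in> set (p @ [y])")
      case True
      have "(z, y) \<in> rtrancl_on (- {x}) E"
        by (rule path_walk[of "p @ [y]"])
          (use path True in \<open>auto simp: path_def successively_append_iff\<close>)
      then show False using acycD[OF acyc_E xz] E_sym[OF yx] \<open>z \<noteq> y\<close> by blast
    next
      case False
      then have "path (p @ [y, x, z])"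
        using path xz E_irrefl[OF xz] E_sub
        by (auto simp: path_def successively_append_iff successively_Cons)
      then show False using assms by (auto simp: longest_def)
    qed
  qed
  then show ?thesis using E_sym[OF yx] by blast
qed

text \<open>For a neighbour \<open>u\<close> of \<open>w\<close> this is the component of
  \<open>u\<close> once \<open>w\<close> is deleted.\<close>

definition branch :: "'a \<Rightarrow> 'a \<Rightarrow> 'a set" where
  "branch w u = {v. (u, v) \<in> rtrancl_on (- {w}) E}"

lemma branch_self: "(w, u) \<in> E \<Longrightarrow> u \<in> branch w u"
  using E_irrefl by (auto simp: branch_def)

lemma branch_sub: "u \<in> V \<Longrightarrow> branch w u \<subseteq> V - {w}"
proof
  fix v assume "u \<in> V" "v \<in> branch w u"
  then have "(u, v) \<in> rtrancl_on (- {w}) E" by (simp add: branch_def)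
  then show "v \<in> V - {w}" using \<open>u \<in> V\<close> E_sub by (induction rule: rtrancl_on_induct) auto
qed

lemma branch_closed: "v \<in> branch w u \<Longrightarrow> (v, z) \<in> E \<Longrightarrow> z \<noteq> w \<Longrightarrow> z \<in> branch w u"
  by (auto simp: branch_def intro: rtrancl_on_into_rtrancl_on)

text \<open>Two neighbours of \<open>w\<close> in one branch would close a cycle through
  \<open>w\<close>.\<close>

lemma branch_nbr: "(w, u) \<in> E \<Longrightarrow> (w, v) \<in> E \<Longrightarrow> v \<in> branch w u \<Longrightarrow> v = u"
  using acycD[OF acyc_E, of w u v] by (simp add: branch_def)

lemma branch_disjoint:
  assumes "(w, u) \<in> E" "(w, u') \<in> E" "u \<noteq> u'"
  shows "branch w u \<inter> branch w u' = {}"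
proof -
  have "u' \<in> branch w u" if "v \<in> branch w u" "v \<in> branch w u'" for v
    using that rtrancl_on_symD[OF sym_E] unfolding branch_def by (blast intro: rtrancl_on_trans)
  then show ?thesis using branch_nbr assms by blast
qed

lemma conn_branch: "(w, u) \<in> E \<Longrightarrow> conn_set E (branch w u)"
  unfolding branch_def by (rule conn_set_component[OF sym_E]) (use E_irrefl in auto)

text \<open>Replacing \<open>q\<close> by the detour through \<open>a\<close> and \<open>g\<close>
  gives another path, so \<open>q\<close> is at least as long as this detour.\<close>

lemma longest_extend:
  assumes "longest (p @ w # q)" "(w, a) \<in> E" "(a, g) \<in> E" "a \<notin> set (p @ w # q)" "g \<notin> set (p @ w # q)"
  shows "2 \<le> length q"
proof -
  have "path (p @ [w, a, g])"
    using assms E_irrefl[OF assms(3)] E_sub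
    by (auto simp: longest_def path_def successively_append_iff successively_Cons)
  then show ?thesis using assms(1) by (fastforce simp: longest_def)
qed

section \<open>Improving a tree that is not a caterpillar\<close>

text \<open>This moves the branches of \<open>a\<close> to the last vertex of \<open>q\<close>; the
  hypothesis \<open>le\<close> says that this is the favourable end of the path.\<close>

lemma improve:
  assumes longest: "longest (p @ w # q)" and wa: "(w, a) \<in> E" and ag: "(a, g) \<in> E"
    and off: "a \<notin> set (p @ w # q)" "g \<notin> set (p @ w # q)"
    and le: "card {S \<in> csets E (branch w (hd q)). hd q \<in> S}
      \<le> card {S \<in> csets E (branch w (last p)). last p \<in> S}"
  obtains E' f where "tree_rel E' V" "bij_betw f V V" "\<And>v. card (E' `` {v}) = card (E `` {f v})"
    "card (csets E' V) < card (csets E V)"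
proof -
  have "path (p @ w # q)" using longest by (simp add: longest_def)
  then have dist: "distinct (p @ w # q)" and succ: "successively (\<lambda>u v. (u, v) \<in> E) (p @ w # q)"
    by (simp_all add: path_def)
  have "2 \<le> length q" using longest_extend[OF longest wa ag off] .
  then have q_ne: "q \<noteq> []" by auto
  have "longest (rev q @ w # rev p)" using longest_rev[OF longest] by simp
  from longest_extend[OF this wa ag] off have "2 \<le> length p" by simp
  then have p_ne: "p \<noteq> []" by auto
  define b c where "b = hd q" and "c = last p"
  obtain r y x where q_eq: "q = r @ [y, x]"
  proof -
    have "q = butlast q @ [last q]" "butlast q \<noteq> []"
      using \<open>2 \<le> length q\<close> q_ne by (simp_all, cases q rule: rev_cases, auto)
    moreover from this have "butlast q = butlast (butlast q) @ [last (butlast q)]" by simp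
    ultimately have "q = butlast (butlast q) @ [last (butlast q), last q]"
      by (metis append.assoc append_Cons append_Nil)
    then show thesis using that by blast
  qed
  have leaf: "E `` {x} = {y}"
    using longest_end_leaf[of "p @ w # r" y x] longest q_eq by simp
  have wb: "(w, b) \<in> E" and wc: "(w, c) \<in> E" and succ_q: "successively (\<lambda>u v. (u, v) \<in> E) q"
    using succ p_ne q_ne E_sym by (auto simp: successively_append_iff successively_Cons b_def c_def)
  have b_q: "b \<in> set q" and c_p: "c \<in> set p" using p_ne q_ne by (auto simp: b_def c_def)
  have abc: "a \<noteq> b" "a \<noteq> c" "b \<noteq> c" using b_q c_p off dist by auto
  \<comment> \<open>The side \<open>q\<close> has at least two vertices, so its first and last
    vertices differ.\<close>
  have "b \<noteq> x" using dist by (cases r) (auto simp: b_def q_eq)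

  define A where "A = branch w a"
  define B where "B = branch w b"
  define C where "C = branch w c"
  \<comment> \<open>\<open>K\<close> consists of \<open>w\<close> and all branches at
    \<open>w\<close> other than those of \<open>a\<close> and \<open>b\<close>; in particular it
    contains \<open>C\<close>.\<close>
  define K where "K = V - A - B"
  define G where "G = A - {a}"
  define V\<^sub>0 where "V\<^sub>0 = insert a (K \<union> B)"
  have in_V: "w \<in> V" "a \<in> V" "b \<in> V" "c \<in> V" using wa wb wc E_sub by auto
  have sub: "A \<subseteq> V - {w}" "B \<subseteq> V - {w}" "C \<subseteq> V - {w}"
    using branch_sub in_V by (simp_all add: A_def B_def C_def)
  have self: "a \<in> A" "b \<in> B" "c \<in> C" using branch_self wa wb wc by (simp_all add: A_def B_def C_def)
  have branches_disj: "A \<inter> B = {}" "A \<inter> C = {}" "B \<inter> C = {}"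
    using branch_disjoint wa wb wc abc by (simp_all add: A_def B_def C_def)
  have V_eq: "V = V\<^sub>0 \<union> G" and V0_G: "V\<^sub>0 \<inter> G = {}"
    using sub self branches_disj in_V by (auto simp: V\<^sub>0_def K_def G_def)
  have "set q \<subseteq> B"
    using path_walk[OF succ_q b_q, of _ "- {w}"] dist by (auto simp: B_def branch_def)
  then have xy_B: "x \<in> B" "y \<in> B" by (auto simp: q_eq)
  have x_a: "x \<noteq> a" using xy_B self branches_disj by blast
  have edge_A: "v = w \<or> v \<in> A" if "(u, v) \<in> E" "u \<in> A" for u v
    using that branch_closed unfolding A_def by blast
  have edge_B: "v = w \<or> v \<in> B" if "(u, v) \<in> E" "u \<in> B" for u v
    using that branch_closed unfolding B_def by blast

  have less: "card {S \<in> csets E V\<^sub>0. x \<in> S} < card {S \<in> csets E V\<^sub>0. a \<in> S}"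
    unfolding V\<^sub>0_def
  proof (rule card_csets_leaf_less[of E K B a w b x y C c])
    show "v = w" if "v \<in> K \<union> B" "(a, v) \<in> E" for v
      using that edge_A self branches_disj by (auto simp: K_def)
    show "u = w \<and> v = b" if "u \<in> K" "v \<in> B" "(u, v) \<in> E" for u v
      using that edge_B[of v u] E_sym[of u v] branch_nbr[of w b v] wb by (auto simp: K_def B_def)
    show "finite K" "finite B" using fin finite_subset[OF sub(2)] by (auto simp: K_def)
    show "conn_set E B" using conn_branch wb by (simp add: B_def)
    show "x \<noteq> y" "(x, y) \<in> E" using leaf E_irrefl by blast+
    show "v = y" if "(x, v) \<in> E" for v using leaf that by blast
    show "C \<subseteq> K - {w}" using sub branches_disj by (auto simp: K_def)
    show "card {S \<in> csets E B. b \<in> S} \<le> card {S \<in> csets E C. c \<in> S}"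
      using le by (simp add: B_def C_def b_def c_def)
    show "a \<notin> K \<union> B" using self branches_disj by (auto simp: K_def)
    show "K \<inter> B = {}" "w \<in> K" using in_V sub by (auto simp: K_def)
  qed (use sym_E self xy_B \<open>b \<noteq> x\<close> wa wb wc E_sym in auto)

  interpret branch_move E V\<^sub>0 G a x
  proof
    show "E \<subseteq> (V\<^sub>0 \<union> G) \<times> (V\<^sub>0 \<union> G)" "conn_set E (V\<^sub>0 \<union> G)"
      using E_sub conn_V unfolding V_eq by auto
    show "finite V\<^sub>0" "finite G" using fin unfolding V_eq by auto
    \<comment> \<open>Since \<open>g\<close> lies off the path it is not \<open>w\<close>, so it
      belongs to the branch of \<open>a\<close> and something is really moved.\<close>
    have "g \<in> A" using edge_A[OF ag self(1)] off by auto
    then show "G \<noteq> {}" using E_irrefl[OF ag] by (auto simp: G_def)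
    show "a \<in> V\<^sub>0" "x \<in> V\<^sub>0" using xy_B by (simp_all add: V\<^sub>0_def)
    show "u = a" if "u \<in> V\<^sub>0" "v \<in> G" "(u, v) \<in> E" for u v
      using that edge_A[of v u] E_sym[of u v] branch_nbr[of w a v] wa V0_G
      by (auto simp: G_def A_def)
  qed (use sym_E irrefl_E acyc_E V0_G in auto)

  have nbr_a: "E `` {a} \<inter> V\<^sub>0 = {w}"
  proof (intro equalityI subsetI)
    fix u assume u: "u \<in> E `` {a} \<inter> V\<^sub>0"
    then have "u = w \<or> u \<in> A" using edge_A self by blast
    moreover have "u \<notin> A" using u no_loop branches_disj by (auto simp: V\<^sub>0_def K_def)
    ultimately show "u \<in> {w}" by blast
  next
    fix u assume "u \<in> {w}"
    then show "u \<in> E `` {a} \<inter> V\<^sub>0" using E_sym[OF wa] in_V sub by (auto simp: V\<^sub>0_def K_def)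
  qed
  show thesis
  proof (rule that)
    have "irrefl E'"
      using E_irrefl by (auto simp: irrefl_def E'_iff)
    then show "tree_rel E' V"
      unfolding V_eq using sym_E' E'_sub finV conn_E' acyc_E' by unfold_locales auto
    show "bij_betw \<tau> V V"
      using xy_B sub in_V by (intro bij_betw_transpose_iff) auto
    show "card (E' `` {v}) = card (E `` {\<tau> v})" for v
      by (rule degree_E'[OF leaf nbr_a]) (use xy_B x_a in \<open>auto simp: V\<^sub>0_def\<close>)
    show "card (csets E' V) < card (csets E V)"
      unfolding V_eq by (rule card_csets_E'[OF less]) (use nbr_a in auto)
  qed
qed

lemma improve_non_caterpillar:
  assumes "\<And>p. path p \<Longrightarrow> \<exists>v\<in>V - set p. \<forall>w\<in>set p. (v, w) \<notin> E"
  obtains E' f where "tree_rel E' V" "bij_betw f V V" "\<And>v. card (E' `` {v}) = card (E `` {f v})"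
    "card (csets E' V) < card (csets E V)"
proof -
  obtain p where longest: "longest p" using longest_exists by blast
  then have path: "path p" by (simp add: longest_def)
  \<comment> \<open>\<open>Z\<close> is the path with its neighbours. An edge leaving
    \<open>Z\<close> starts off the path, as otherwise its other end would be in \<open>Z\<close>;
    this supplies \<open>a\<close> and \<open>g\<close>.\<close>
  define Z where "Z = set p \<union> {v. \<exists>w\<in>set p. (v, w) \<in> E}"
  obtain v where v: "v \<in> V" "v \<notin> Z" using assms[OF path] by (auto simp: Z_def)
  have "hd p \<in> V" "hd p \<in> Z" using path by (auto simp: path_def Z_def)
  from conn_set_crossing[OF conn_V this v] obtain a g
    where ag: "a \<in> Z" "g \<notin> Z" "(a, g) \<in> E" by blast
  have "a \<notin> set p" using ag E_sym by (auto simp: Z_def)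
  then obtain w where w: "w \<in> set p" "(a, w) \<in> E" using ag by (auto simp: Z_def)
  obtain p\<^sub>1 p\<^sub>2 where p_eq: "p = p\<^sub>1 @ w # p\<^sub>2" using w by (meson split_list)
  have off: "a \<notin> set (p\<^sub>1 @ w # p\<^sub>2)" "g \<notin> set (p\<^sub>1 @ w # p\<^sub>2)"
    using \<open>a \<notin> set p\<close> ag by (auto simp: Z_def p_eq)
  have wa: "(w, a) \<in> E" using w E_sym by blast
  have longest': "longest (p\<^sub>1 @ w # p\<^sub>2)" "longest (rev p\<^sub>2 @ w # rev p\<^sub>1)"
    using longest longest_rev[OF longest] by (simp_all add: p_eq)
  let ?n = "\<lambda>u. card {S \<in> csets E (branch w u). u \<in> S}"
  have ne: "p\<^sub>1 \<noteq> []" "p\<^sub>2 \<noteq> []"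
    using longest_extend[OF longest'(1) wa ag(3) off]
      longest_extend[OF longest'(2) wa ag(3)] off by auto
  show thesis
  \<comment> \<open>Reversing the path exchanges its two sides at \<open>w\<close>, so one of the
    two orientations satisfies the comparison.\<close>
  proof (cases "?n (hd p\<^sub>2) \<le> ?n (last p\<^sub>1)")
    case True
    then show thesis using improve[OF longest'(1) wa ag(3) off] that by blast
  next
    case False
    then have "?n (hd (rev p\<^sub>1)) \<le> ?n (last (rev p\<^sub>2))"
      using ne by (simp add: hd_rev last_rev)
    then show thesis using improve[OF longest'(2) wa ag(3)] off that by auto
  qed
qed

end

section \<open>Trees as pair graphs\<close>

lemma pair_graph_iff:
  "pair_graph T \<longleftrightarrow> sym (parcs T) \<and> irrefl (parcs T) \<and> parcs T \<subseteq> pverts T \<times> pverts T \<and> finite (pverts T)"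
proof
  assume "pair_graph T"
  then interpret pair_graph T .
  show "sym (parcs T) \<and> irrefl (parcs T) \<and> parcs T \<subseteq> pverts T \<times> pverts T \<and> finite (pverts T)"
    using pair_sym_arcs pair_no_loops arc_fst_in_verts arc_snd_in_verts pair_finite_verts
    by (fastforce simp: symmetric_def irrefl_def)
next
  assume *: "sym (parcs T) \<and> irrefl (parcs T) \<and> parcs T \<subseteq> pverts T \<times> pverts T \<and> finite (pverts T)"
  then have "finite (parcs T)" by (meson finite_SigmaI finite_subset)
  with * show "pair_graph T"
    by unfold_locales (auto simp: symmetric_def irrefl_def)
qed

lemma connected_with_proj_iff:
  assumes "sym (parcs T)"
  shows "connected (with_proj T) \<longleftrightarrow> conn_set (parcs T) (pverts T)"
proof -
  \<comment> \<open>Connectedness of a digraph refers to the symmetric closure of its arcs, which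
    adds nothing here.\<close>
  have "(parcs T)\<^sup>s = parcs T" using assms by (auto simp: symcl_def dest: symD)
  then show ?thesis by (simp add: connected_conv conn_set_def)
qed

text \<open>Whenever a new first vertex already occurs on the path, the part before that occurrence
  is cut off.\<close>

lemma rtrancl_on_distinct_list:
  assumes "(a, b) \<in> rtrancl_on F r"
  obtains p where "hd p = a" "last p = b" "p \<noteq> []" "distinct p" "set p \<subseteq> F" "set (vwalk_arcs p) \<subseteq> r"
proof -
  have "\<exists>p. hd p = a \<and> last p = b \<and> p \<noteq> [] \<and> distinct p \<and> set p \<subseteq> F \<and> set (vwalk_arcs p) \<subseteq> r"
    using assms
  proof (induction rule: converse_rtrancl_on_induct)
    case base
    then show ?case by (intro exI[of _ "[b]"]) simp
  next
    case (step u v)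
    then obtain p where p: "hd p = v" "last p = b" "p \<noteq> []" "distinct p" "set p \<subseteq> F"
      "set (vwalk_arcs p) \<subseteq> r" by blast
    show ?case
    proof (cases "u \<in> set p")
      case True
      then obtain p\<^sub>1 p\<^sub>2 where "p = p\<^sub>1 @ u # p\<^sub>2" by (meson split_list)
      then show ?thesis
        using p set_vwalk_arcs_append2[of "u # p\<^sub>2" p\<^sub>1] by (intro exI[of _ "u # p\<^sub>2"]) auto
    next
      case False
      then show ?thesis using p step by (intro exI[of _ "u # p"]) auto
    qed
  qed
  then show thesis using that by blast
qed

lemma pawalk_verts_vwalk_arcs: "pawalk_verts u (vwalk_arcs (u # p)) = u # p"
  by (induction p arbitrary: u) auto

lemma pcas_vwalk_arcs: "pcas u (vwalk_arcs (u # p)) (last (u # p))"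
  by (induction p arbitrary: u) auto

lemma pawalk_verts_snoc: "pcas u es (fst e) \<Longrightarrow> pawalk_verts u (es @ [e]) = pawalk_verts u es @ [snd e]"
  by (induction es arbitrary: u) auto

lemma pcas_snoc: "pcas u (es @ [e]) v \<longleftrightarrow> pcas u es (fst e) \<and> v = snd e"
  by (induction es arbitrary: u) auto

lemma pcas_last_mem: "pcas u es v \<Longrightarrow> v \<in> set (pawalk_verts u es)"
  by (induction es arbitrary: u) auto

lemma rtrancl_on_pcas:
  "pcas u es v \<Longrightarrow> set es \<subseteq> r \<Longrightarrow> set (pawalk_verts u es) \<subseteq> F \<Longrightarrow> (u, v) \<in> rtrancl_on F r"
proof (induction es arbitrary: u)
  case (Cons e es)
  then have "(snd e, v) \<in> rtrancl_on F r" by simp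
  then show ?case using Cons.prems
    by (intro converse_rtrancl_on_into_rtrancl_on[of u "snd e"]) (auto simp: prod.expand)
qed simp

text \<open>A cycle through \<open>w\<close> is a path between two distinct neighbours of
  \<open>w\<close> that avoids \<open>w\<close>, closed up by two arcs at \<open>w\<close>.\<close>

lemma no_long_cycle_iff:
  assumes "pair_graph T"
  shows "(\<nexists>c. pre_digraph.cycle (with_proj T) c \<and> 3 \<le> length c) \<longleftrightarrow> acyc (parcs T)"
proof -
  interpret pair_graph T by fact
  have cycle_iff: "pre_digraph.cycle (with_proj T) c \<longleftrightarrow>
    (\<exists>u. u \<in> pverts T \<and> set c \<subseteq> parcs T \<and> pcas u c u \<and> distinct (tl (pawalk_verts u c)) \<and> c \<noteq> [])" for c
    by (auto simp: cycle_def awalk_def)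
  show ?thesis
  proof (intro iffI notI)
    assume no_cycle: "\<nexists>c. pre_digraph.cycle (with_proj T) c \<and> 3 \<le> length c"
    show "acyc (parcs T)"
      unfolding acyc_def
    proof (intro allI impI notI)
      fix w a b
      assume wab: "(w, a) \<in> parcs T" "(w, b) \<in> parcs T" "a \<noteq> b"
        and "(a, b) \<in> rtrancl_on (- {w}) (parcs T)"
      then obtain p where p: "hd p = a" "last p = b" "p \<noteq> []" "distinct p" "set p \<subseteq> - {w}"
        "set (vwalk_arcs p) \<subseteq> parcs T" using rtrancl_on_distinct_list by metis
      let ?p = "p @ [w]"
      let ?c = "vwalk_arcs (w # ?p)"
      have "set ?c \<subseteq> parcs T"
        using p wab arcs_symmetric by (auto simp: vwalk_arcs_append set_vwalk_arcs_snoc)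
      moreover have "pcas w ?c w" using pcas_vwalk_arcs[of w ?p] by simp
      moreover have "distinct (tl (pawalk_verts w ?c))"
        unfolding pawalk_verts_vwalk_arcs using p by auto
      moreover have "w \<in> pverts T" using wab in_arcsD1 by blast
      moreover have len: "3 \<le> length ?c"
      proof -
        have "length (vwalk_arcs q) = length q - 1" for q :: "'a list"
          using vwalk_length_simp[of q] by (simp only: vwalk_length_def)
        then have "length ?c = length p + 1" by simp
        \<comment> \<open>The ends \<open>a\<close> and \<open>b\<close> differ, so \<open>p\<close>
          has at least two vertices; this rules out the closed walk along a single edge.\<close>
        moreover have "length p \<noteq> 1" using p wab(3) by (auto simp: length_Suc_conv)
        moreover have "length p \<noteq> 0" using p by simp
        ultimately show ?thesis by linarith
      qed
      moreover from len have "?c \<noteq> []" by auto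
      ultimately show False using no_cycle cycle_iff by blast
    qed
  next
    assume acyc: "acyc (parcs T)" and "\<exists>c. pre_digraph.cycle (with_proj T) c \<and> 3 \<le> length c"
    then obtain u c where c: "set c \<subseteq> parcs T" "pcas u c u" "distinct (tl (pawalk_verts u c))" "3 \<le> length c"
      using cycle_iff by blast
    obtain e es where c_eq: "c = e # es" using c by (cases c) auto
    have "es \<noteq> []" using c(4) c_eq by auto
    then obtain d e' where es_eq: "es = d @ [e']" by (meson rev_exhaust)
    define a b where "a = snd e" and "b = fst e'"
    have ends: "fst e = u" "snd e' = u" "pcas a d b"
      using c(2) by (auto simp: c_eq es_eq pcas_snoc a_def b_def)
    then have "distinct (pawalk_verts a d @ [u])"
      using c(3) pawalk_verts_snoc[of a d e'] by (simp add: c_eq es_eq a_def b_def)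
    then have dist: "distinct (pawalk_verts a d)" "u \<notin> set (pawalk_verts a d)" by auto
    \<comment> \<open>Three arcs leave at least one between the first and the last, so distinctness
      of the vertices separates \<open>a\<close> from \<open>b\<close>.\<close>
    have "d \<noteq> []" using c(4) by (auto simp: c_eq es_eq)
    then obtain f fs where d_eq: "d = f # fs" by (cases d) auto
    have "a \<noteq> b" using dist(1) ends(3) pcas_last_mem[of "snd f" fs b] by (auto simp: d_eq)
    have "(u, a) = e" "(b, u) = e'" using ends by (simp_all add: a_def b_def prod_eq_iff)
    then have "(u, a) \<in> parcs T" "(b, u) \<in> parcs T"
      using c(1) by (simp_all add: c_eq es_eq)
    moreover have "(a, b) \<in> rtrancl_on (- {u}) (parcs T)"
      by (rule rtrancl_on_pcas[OF ends(3)]) (use c(1) dist in \<open>auto simp: c_eq es_eq\<close>)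
    ultimately show False using acycD[OF acyc] arcs_symmetric \<open>a \<noteq> b\<close> by blast
  qed
qed

lemma undirected_tree_iff: "undirected_tree T \<longleftrightarrow> tree_rel (parcs T) (pverts T)"
  unfolding undirected_tree_def tree_rel_def
  using pair_graph_iff[of T] connected_with_proj_iff[of T] no_long_cycle_iff[of T] by blast

section \<open>Subtrees and their vertex sets\<close>

lemma rtrancl_on_last_departure:
  assumes "(u, v) \<in> rtrancl_on F r" "u \<noteq> v"
  obtains a where "(u, a) \<in> r" "(a, v) \<in> rtrancl_on (- {u}) r"
proof -
  have "u \<noteq> v \<longrightarrow> (\<exists>a. (u, a) \<in> r \<and> (a, v) \<in> rtrancl_on (- {u}) r)"
    using assms(1)
  proof (induction rule: rtrancl_on_induct)
    case (step y z)
    show ?case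
    \<comment> \<open>A return to \<open>u\<close> restarts the search: the step after it becomes
      the new departure.\<close>
    proof (cases "y = u")
      case True
      then show ?thesis using step.hyps(2) by auto
    next
      case False
      then show ?thesis using step by (auto intro: rtrancl_on_into_rtrancl_on)
    qed
  qed simp
  then show thesis using that assms(2) by blast
qed

text \<open>If an edge of \<open>E\<close> inside \<open>S\<close> were missing from
  \<open>F\<close>, a walk in \<open>F\<close> between its ends would close a cycle with it.\<close>

lemma (in tree_rel) connected_subgraph_induced:
  assumes F: "F \<subseteq> E \<inter> S \<times> S" and conn: "conn_set F S"
  shows "F = E \<inter> S \<times> S"
proof (rule ccontr)
  assume "F \<noteq> E \<inter> S \<times> S"
  then obtain u v where uv: "(u, v) \<in> E" "u \<in> S" "v \<in> S" "(u, v) \<notin> F" using F by blast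
  then have "(u, v) \<in> rtrancl_on S F" using conn by (simp add: conn_set_def)
  then obtain a where a: "(u, a) \<in> F" "(a, v) \<in> rtrancl_on (- {u}) F"
    using rtrancl_on_last_departure E_irrefl[OF uv(1)] by metis
  have "F \<subseteq> E" using F by blast
  then have "(a, v) \<in> rtrancl_on (- {u}) E" using a(2) rtrancl_on_mono[of F E] by blast
  then have "a = v" using acycD[OF acyc_E _ uv(1)] a(1) \<open>F \<subseteq> E\<close> by blast
  with a uv show False by simp
qed

text \<open>Taking vertex sets is a bijection: it is injective because subtrees are induced, and
  every connected set induces a subtree.\<close>

lemma num_subtrees_eq_card_csets:
  assumes "tree_rel (parcs T) (pverts T)"
  shows "num_subtrees T = card (csets (parcs T) (pverts T))"
proof -
  interpret tree_rel "parcs T" "pverts T" by fact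
  have wf: "wf_digraph (with_proj T)"
    using E_sub by unfold_locales auto
  have subtreeD: "pverts H \<subseteq> pverts T" "conn_set (parcs H) (pverts H)"
      "parcs H = parcs T \<inter> pverts H \<times> pverts H" if "H \<in> subtrees T" for H
  proof -
    have H: "pair_graph H" "subgraph (with_proj H) (with_proj T)" "connected (with_proj H)"
      using that by (auto simp: subtrees_def)
    from H(2) have sub: "pverts H \<subseteq> pverts T" "parcs H \<subseteq> parcs T" by (auto simp: subgraph_def)
    then show "pverts H \<subseteq> pverts T" by simp
    show conn: "conn_set (parcs H) (pverts H)"
      using H connected_with_proj_iff pair_graph_iff by blast
    show "parcs H = parcs T \<inter> pverts H \<times> pverts H"
      by (rule connected_subgraph_induced[OF _ conn]) (use sub H(1) pair_graph_iff in blast)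
  qed
  have "inj_on pverts (subtrees T)"
  proof (rule inj_onI)
    fix H H' assume "H \<in> subtrees T" "H' \<in> subtrees T" "pverts H = pverts H'"
    with subtreeD(3) have "parcs H = parcs H'" by metis
    with \<open>pverts H = pverts H'\<close> show "H = H'" by simp
  qed
  moreover have "pverts ` subtrees T = csets (parcs T) (pverts T)"
  proof (intro equalityI subsetI)
    fix S assume "S \<in> pverts ` subtrees T"
    then obtain H where H: "H \<in> subtrees T" "S = pverts H" by blast
    have "conn_set (parcs T) (id ` S)"
      by (rule conn_set_map[of "parcs H"]) (use subtreeD[OF H(1)] H(2) in auto)
    then show "S \<in> csets (parcs T) (pverts T)" using subtreeD[OF H(1)] H(2) by (simp add: csets_def)
  next
    fix S assume S: "S \<in> csets (parcs T) (pverts T)"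
    define H where "H = \<lparr>pverts = S, parcs = parcs T \<inter> S \<times> S\<rparr>"
    have "S \<subseteq> pverts T" using S by (simp add: csets_def)
    have symH: "sym (parcs H)" using sym_E by (auto simp: H_def sym_def)
    have "conn_set (parcs H) (id ` S)"
      by (rule conn_set_map[of "parcs T"]) (use S in \<open>auto simp: csets_def H_def\<close>)
    then have "connected (with_proj H)" using connected_with_proj_iff[OF symH] by (simp add: H_def)
    moreover have pgH: "pair_graph H"
      using symH E_irrefl finite_subset[OF \<open>S \<subseteq> pverts T\<close> fin] unfolding pair_graph_iff by (auto simp: H_def irrefl_def)
    moreover have "wf_digraph (with_proj H)"
      by unfold_locales (auto simp: H_def)
    then have "subgraph (with_proj H) (with_proj T)"
      using wf \<open>S \<subseteq> pverts T\<close> by (intro subgraphI) (auto simp: H_def)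
    ultimately have "H \<in> subtrees T" by (simp add: subtrees_def)
    then show "S \<in> pverts ` subtrees T" by (force simp: H_def)
  qed
  ultimately show ?thesis unfolding num_subtrees_def by (metis card_image)
qed

section \<open>Degree sequences and the contradiction to minimality\<close>

lemma degree_sequence_eqI:
  assumes "bij_betw f (pverts T) (pverts T)" "pverts T' = pverts T"
    and "\<And>v. card (parcs T' `` {v}) = card (parcs T `` {f v})"
  shows "degree_sequence T' = degree_sequence T"
proof -
  have deg: "out_degree (with_proj H) = (\<lambda>v. card (parcs H `` {v}))" for H :: "'a pair_pre_digraph"
  proof
    fix v
    have "out_arcs (with_proj H) v = Pair v ` (parcs H `` {v})" by force
    then show "out_degree (with_proj H) v = card (parcs H `` {v})"
      by (simp add: out_degree_def card_image inj_on_def)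
  qed
  have "image_mset (out_degree (with_proj T')) (mset_set (pverts T'))
    = image_mset (out_degree (with_proj T)) (image_mset f (mset_set (pverts T)))"
    by (simp add: assms deg multiset.map_comp comp_def)
  also have "image_mset f (mset_set (pverts T)) = mset_set (pverts T)"
    using assms(1) by (simp add: image_mset_mset_set bij_betw_def)
  finally show ?thesis by (simp add: degree_sequence_def)
qed

lemma set_vwalk_arcs_sub_iff: "set (vwalk_arcs p) \<subseteq> r \<longleftrightarrow> successively (\<lambda>u v. (u, v) \<in> r) p"
  by (induction p rule: vwalk_arcs.induct) auto

theorem theorem2p1:
  fixes \<pi> :: "nat list" and k :: nat and Tmin :: "'a pair_pre_digraph"
  assumes "(trees_with_degree_sequence \<pi> :: 'a pair_pre_digraph set) \<noteq> {}"
    and "sorted_wrt (\<ge>) \<pi>"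
    and "k \<le> length \<pi>"
    and "\<forall>i < k. \<pi> ! i \<ge> 2"
    and "\<forall>i. k \<le> i \<and> i < length \<pi> \<longrightarrow> \<pi> ! i = 1"
    and "is_arg_min num_subtrees (\<lambda>T. T \<in> trees_with_degree_sequence \<pi>) Tmin"
  shows "caterpillar Tmin"
proof (rule ccontr)
  assume not_cat: "\<not> caterpillar Tmin"
  have Tmin: "undirected_tree Tmin" "degree_sequence Tmin = \<pi>"
    using assms(6) by (simp_all add: is_arg_min_def trees_with_degree_sequence_def)
  have minimal: "num_subtrees Tmin \<le> num_subtrees T"
    if "undirected_tree T" "degree_sequence T = \<pi>" for T :: "'a pair_pre_digraph"
    using that assms(6) by (simp add: is_arg_min_def trees_with_degree_sequence_def not_less)
  interpret tree_rel "parcs Tmin" "pverts Tmin"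
    using Tmin(1) by (simp add: undirected_tree_iff)
  have "\<exists>v\<in>pverts Tmin - set p. \<forall>w\<in>set p. (v, w) \<notin> parcs Tmin" if "path p" for p
  proof -
    have "vpath p (with_proj Tmin)"
      using that by (simp add: path_def vpath_def vwalk_def set_vwalk_arcs_sub_iff)
    then show ?thesis using not_cat Tmin(1) by (auto simp: caterpillar_def)
  qed
  then obtain E' f where E': "tree_rel E' (pverts Tmin)" "bij_betw f (pverts Tmin) (pverts Tmin)"
    "\<And>v. card (E' `` {v}) = card (parcs Tmin `` {f v})"
    "card (csets E' (pverts Tmin)) < card (csets (parcs Tmin) (pverts Tmin))"
    using improve_non_caterpillar by blast
  \<comment> \<open>The improved tree lives on the same vertices and has the same degree sequence,
    so it competes with \<open>Tmin\<close>.\<close>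
  let ?T = "\<lparr>pverts = pverts Tmin, parcs = E'\<rparr>"
  have "undirected_tree ?T" using E'(1) by (simp add: undirected_tree_iff)
  moreover have "degree_sequence ?T = \<pi>"
    using degree_sequence_eqI[of f Tmin ?T] E'(2,3) Tmin(2) by simp
  moreover have "num_subtrees ?T < num_subtrees Tmin"
    using E'(4) num_subtrees_eq_card_csets[of ?T] num_subtrees_eq_card_csets[of Tmin] E'(1) tree_rel_axioms
    by simp
  ultimately show False using minimal[of ?T] by simp
qed

end
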